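(* Let $\mathbf A$ be a finite hoop. (i) There exist a finite sequence of finite MV-chains $(\mathbf M_{1},\dots,\mathbf M_{n})$ and appropriate product morphisms $f_1,\dots,f_{n-1}$ such that $\mathbf A\cong\mathbf M_{1}\ltimes_{f_1}(\mathbf M_{2}\ltimes_{f_2}(\mathbf M_{3}\cdots\ltimes_{f_{n-2}}(\mathbf M_{n-1}\ltimes_{f_{n-1}}\mathbf M_{n})\cdots))$. (ii) There exist a finite sequence of finite MV-chains $(\mathbf M_{1},\dots,\mathbf M_{n})$ and appropriate product morphisms $g_1,\dots,g_{n-1}$ such that $\mathbf A\cong(((\mathbf M_{1}\ltimes_{g_1}\mathbf M_{2})\ltimes_{g_2}\mathbf M_{3})\cdots\ltimes_{g_{n-2}}\mathbf M_{n-1})\ltimes_{g_{n-1}}\mathbf M_{n}$.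
   Context: A hoop is an algebra $\mathbf A=(A;\cdot,\rightarrow,1)$ of type $\langle 2,2,0\rangle$ such that $(A;\cdot,1)$ is a commutative monoid and the identities $x\rightarrow x=1$, $(x\cdot y)\rightarrow z=x\rightarrow(y\rightarrow z)$ and $x\cdot(x\rightarrow y)=y\cdot(y\rightarrow x)$ hold. The order is $x\leq y$ iff $x\rightarrow y=1$; infima exist and $x\wedge y=x\cdot(x\rightarrow y)$. A finite MV-chain is regarded as a hoop via its reduct $(M;\cdot,\rightarrow,1)$ (multiplication the Łukasiewicz t-norm-type monoid operation and $\rightarrow$ its residuum). A map $f\colon C\to B$ between hoops is a product morphism if $f(1)=1$ and $f(x)\cdot f(y)=f(x\cdot y)=f(x)\wedge f(y)=f(x\wedge y)$ for all $x,y\in C$. For such $f$, the $f$-product $\mathbf B\ltimes_f\mathbf C$ is the hoop with universe $\{(b,x)\in B\times C\mid b\leq f(x)\}$, constant $(1,1)$ and operations $(a,x)\cdot(b,y)=(a\cdot b,\,x\cdot y)$ and $(a,x)\rightarrow(b,y)=(f(x\rightarrow y)\wedge(a\rightarrow b),\,x\rightarrow y)$. "Appropriate" means each $f_i$ (resp. $g_i$) is a product morphism from the right factor to the left factor of the $f$-product in which it is used. *)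

theory Defs
  imports "HOL-Algebra.Group"
begin

section \<open>Hoops\<close>

record 'a hoop_sig = "'a monoid" +
  imp :: "['a, 'a] \<Rightarrow> 'a"  (infixr "\<leadsto>\<index>" 65)

locale hoop = comm_monoid A for A (structure) +
  assumes imp_closed [intro, simp]:
      "\<lbrakk>x \<in> carrier A; y \<in> carrier A\<rbrakk> \<Longrightarrow> x \<leadsto> y \<in> carrier A"
    and imp_refl: "x \<in> carrier A \<Longrightarrow> x \<leadsto> x = \<one>"
    and imp_curry: "\<lbrakk>x \<in> carrier A; y \<in> carrier A; z \<in> carrier A\<rbrakk>
      \<Longrightarrow> (x \<otimes> y) \<leadsto> z = x \<leadsto> (y \<leadsto> z)"
    and divisibility: "\<lbrakk>x \<in> carrier A; y \<in> carrier A\<rbrakk>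
      \<Longrightarrow> x \<otimes> (x \<leadsto> y) = y \<otimes> (y \<leadsto> x)"

definition hoop_le :: "('a, 'm) hoop_sig_scheme \<Rightarrow> 'a \<Rightarrow> 'a \<Rightarrow> bool" where
  "hoop_le A x y \<longleftrightarrow> x \<leadsto>\<^bsub>A\<^esub> y = \<one>\<^bsub>A\<^esub>"

definition hoop_inf :: "('a, 'm) hoop_sig_scheme \<Rightarrow> 'a \<Rightarrow> 'a \<Rightarrow> 'a" where
  "hoop_inf A x y = x \<otimes>\<^bsub>A\<^esub> (x \<leadsto>\<^bsub>A\<^esub> y)"

definition hoop_iso :: "('a, 'm) hoop_sig_scheme \<Rightarrow> ('b, 'n) hoop_sig_scheme \<Rightarrow> ('a \<Rightarrow> 'b) set" where
  "hoop_iso A B = {h \<in> iso A B. h \<one>\<^bsub>A\<^esub> = \<one>\<^bsub>B\<^esub> \<and>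
     (\<forall>x\<in>carrier A. \<forall>y\<in>carrier A. h (x \<leadsto>\<^bsub>A\<^esub> y) = h x \<leadsto>\<^bsub>B\<^esub> h y)}"

definition hoop_isomorphic :: "('a, 'm) hoop_sig_scheme \<Rightarrow> ('b, 'n) hoop_sig_scheme \<Rightarrow> bool" where
  "hoop_isomorphic A B \<longleftrightarrow> hoop_iso A B \<noteq> {}"


section \<open>MV-chains\<close>

record 'a mv_sig = "'a partial_object" +
  oplus :: "['a, 'a] \<Rightarrow> 'a"
  neg :: "'a \<Rightarrow> 'a"
  bot :: 'a

text \<open>
  Chang's axioms. The one-element algebra is allowed, so that a trivial hoop is a
  one-factor product.
\<close>

locale mv_algebra =
  fixes M :: "('a, 'm) mv_sig_scheme"
  assumes oplus_closed: "\<lbrakk>x \<in> carrier M; y \<in> carrier M\<rbrakk> \<Longrightarrow> oplus M x y \<in> carrier M"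
    and neg_closed: "x \<in> carrier M \<Longrightarrow> neg M x \<in> carrier M"
    and bot_closed: "bot M \<in> carrier M"
    and oplus_assoc: "\<lbrakk>x \<in> carrier M; y \<in> carrier M; z \<in> carrier M\<rbrakk>
      \<Longrightarrow> oplus M (oplus M x y) z = oplus M x (oplus M y z)"
    and oplus_comm: "\<lbrakk>x \<in> carrier M; y \<in> carrier M\<rbrakk> \<Longrightarrow> oplus M x y = oplus M y x"
    and oplus_bot: "x \<in> carrier M \<Longrightarrow> oplus M x (bot M) = x"
    and neg_neg: "x \<in> carrier M \<Longrightarrow> neg M (neg M x) = x"
    and oplus_top: "x \<in> carrier M \<Longrightarrow> oplus M x (neg M (bot M)) = neg M (bot M)"
    and lukasiewicz: "\<lbrakk>x \<in> carrier M; y \<in> carrier M\<rbrakk>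
      \<Longrightarrow> oplus M (neg M (oplus M (neg M x) y)) y = oplus M (neg M (oplus M (neg M y) x)) x"

definition mv_hoop :: "('a, 'm) mv_sig_scheme \<Rightarrow> 'a hoop_sig" where
  "mv_hoop M =
    \<lparr>carrier = carrier M,
     mult = (\<lambda>x y. neg M (oplus M (neg M x) (neg M y))),
     one = neg M (bot M),
     imp = (\<lambda>x y. oplus M (neg M x) y)\<rparr>"

locale finite_mv_chain = mv_algebra +
  assumes finite_carrier: "finite (carrier M)"
    and total: "\<lbrakk>x \<in> carrier M; y \<in> carrier M\<rbrakk>
      \<Longrightarrow> hoop_le (mv_hoop M) x y \<or> hoop_le (mv_hoop M) y x"


section \<open>Product morphisms and f-products\<close>

definition product_morphism ::
    "('c, 'm) hoop_sig_scheme \<Rightarrow> ('b, 'n) hoop_sig_scheme \<Rightarrow> ('c \<Rightarrow> 'b) \<Rightarrow> bool" where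
  "product_morphism C B f \<longleftrightarrow>
     f \<in> carrier C \<rightarrow> carrier B \<and> f \<one>\<^bsub>C\<^esub> = \<one>\<^bsub>B\<^esub> \<and>
     (\<forall>x\<in>carrier C. \<forall>y\<in>carrier C.
        f x \<otimes>\<^bsub>B\<^esub> f y = f (x \<otimes>\<^bsub>C\<^esub> y) \<and>
        f (x \<otimes>\<^bsub>C\<^esub> y) = hoop_inf B (f x) (f y) \<and>
        hoop_inf B (f x) (f y) = f (hoop_inf C x y))"

definition f_product ::
    "('c \<Rightarrow> 'b) \<Rightarrow> ('b, 'm) hoop_sig_scheme \<Rightarrow> ('c, 'n) hoop_sig_scheme \<Rightarrow> ('b \<times> 'c) hoop_sig" where
  "f_product f B C =
    \<lparr>carrier = {(b, x). b \<in> carrier B \<and> x \<in> carrier C \<and> hoop_le B b (f x)},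
     mult = (\<lambda>(a, x) (b, y). (a \<otimes>\<^bsub>B\<^esub> b, x \<otimes>\<^bsub>C\<^esub> y)),
     one = (\<one>\<^bsub>B\<^esub>, \<one>\<^bsub>C\<^esub>),
     imp = (\<lambda>(a, x) (b, y). (hoop_inf B (f (x \<leadsto>\<^bsub>C\<^esub> y)) (a \<leadsto>\<^bsub>B\<^esub> b), x \<leadsto>\<^bsub>C\<^esub> y))\<rparr>"


section \<open>Iterated f-products\<close>

text \<open>
  An iterated product of n factors has a type depending on n. To quantify over n, all
  iterated products live on one type with a free pairing constructor. Taking \<^typ>\<open>nat\<close> as
  the type of the elements of the chains loses no generality, as the chains are finite.
\<close>

datatype nested = Atom nat | Pair nested nested

text \<open>The copy of a structure along a map that is injective on its carrier.\<close>

definition hoop_copy :: "('a \<Rightarrow> 'b) \<Rightarrow> ('a, 'm) hoop_sig_scheme \<Rightarrow> 'b hoop_sig" where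
  "hoop_copy h A = (let r = inv_into (carrier A) h in
    \<lparr>carrier = h ` carrier A,
     mult = (\<lambda>x y. h (r x \<otimes>\<^bsub>A\<^esub> r y)),
     one = h \<one>\<^bsub>A\<^esub>,
     imp = (\<lambda>x y. h (r x \<leadsto>\<^bsub>A\<^esub> r y))\<rparr>)"

lemma hoop_copy_iso:
  assumes "hoop A" "inj_on h (carrier A)"
  shows "h \<in> hoop_iso A (hoop_copy h A)"
proof -
  interpret hoop A by fact
  show ?thesis
    using assms(2) by (auto simp: hoop_iso_def iso_def hom_def bij_betw_def hoop_copy_def Let_def)
qed

definition chain_factor :: "nat mv_sig \<Rightarrow> nested hoop_sig" where
  "chain_factor M = hoop_copy Atom (mv_hoop M)"

definition nested_product ::
    "(nested \<Rightarrow> nested) \<Rightarrow> nested hoop_sig \<Rightarrow> nested hoop_sig \<Rightarrow> nested hoop_sig" where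
  "nested_product f B C = hoop_copy (\<lambda>(b, x). Pair b x) (f_product f B C)"

text \<open>
  In both predicates the i-th morphism goes from the right factor to the left factor of the
  f-product it defines, and there is exactly one morphism less than there are chains.
\<close>

inductive right_nested_product ::
    "nat mv_sig list \<Rightarrow> (nested \<Rightarrow> nested) list \<Rightarrow> nested hoop_sig \<Rightarrow> bool" where
  single: "right_nested_product [M] [] (chain_factor M)"
| step: "\<lbrakk>right_nested_product Ms fs C; product_morphism C (chain_factor M) f\<rbrakk>
    \<Longrightarrow> right_nested_product (M # Ms) (f # fs) (nested_product f (chain_factor M) C)"

inductive left_nested_product ::
    "nat mv_sig list \<Rightarrow> (nested \<Rightarrow> nested) list \<Rightarrow> nested hoop_sig \<Rightarrow> bool" where
  single: "left_nested_product [M] [] (chain_factor M)"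
| step: "\<lbrakk>left_nested_product Ms gs B; product_morphism (chain_factor M) B g\<rbrakk>
    \<Longrightarrow> left_nested_product (Ms @ [M]) (gs @ [g]) (nested_product g B (chain_factor M))"

end

theory Submission imports Defs begin

text \<open>
  Let e be an idempotent of a finite hoop A, F the filter of the elements above e and C the set of
  the x with e \<rightarrow> x = x. Both are subalgebras. Every x in C has a least element f(x) of F above it,
  and f(x) is idempotent; since x \<le> (x \<rightarrow> b) \<rightarrow> b, one gets x \<rightarrow> b = f(x) \<rightarrow> b for b in F. As moreover
  b \<rightarrow> x = x, multiplication (b, x) \<mapsto> bx is an isomorphism from the f-product of F and C onto A.
  If e is a maximal idempotent other than 1, then F is simple; if e is a minimal idempotent
  other than the least element, then C is simple. Simple finite hoops are MV-chains, so
  induction on the cardinality gives (i) from the first choice of e and (ii) from the second.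
\<close>


section \<open>Arithmetic of hoops\<close>

context hoop
begin

abbreviation le (infix "\<preceq>" 50) where "x \<preceq> y \<equiv> hoop_le A x y"

text \<open>This identity is not an axiom. For u = 1 \<leadsto> x and t = x \<leadsto> 1,
  divisibility gives u = x t; a second use of it expresses x as x t s with t s = t, hence x =
  u.\<close>

lemma one_imp:
  assumes x: "x \<in> carrier A"
  shows "\<one> \<leadsto> x = x"
proof -
  have imp_fixed: "\<one> \<leadsto> (a \<leadsto> b) = a \<leadsto> b" if "a \<in> carrier A" "b \<in> carrier A" for a b
    using imp_curry[of \<one> a b] that by simp
  define u t s where "u = \<one> \<leadsto> x" and "t = x \<leadsto> \<one>" and "s = t \<leadsto> \<one>"
  have [simp]: "u \<in> carrier A" "t \<in> carrier A" "s \<in> carrier A"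
    using x by (simp_all add: u_def t_def s_def)
  have u: "u = x \<otimes> t"
    using divisibility[of \<one> x] x by (simp add: u_def t_def)
  have "x \<leadsto> u = \<one>"
    using imp_curry[of x \<one> x] x by (simp add: u_def imp_refl)
  moreover have "u \<leadsto> x = s"
    using imp_curry[of t x x] x by (simp add: u s_def imp_refl m_comm)
  ultimately have "x = u \<otimes> s"
    using divisibility[of u x] x by simp
  also have "\<dots> = x \<otimes> (t \<otimes> s)"
    using x by (simp add: u m_assoc)
  \<comment> \<open>By divisibility t s = 1 \<leadsto> t, and t is an implication, for which this is
    already known to be t.\<close>
  also have "t \<otimes> s = t"
    using divisibility[of \<one> t] imp_fixed[of x \<one>] x by (simp add: s_def) (simp add: t_def)
  finally show ?thesis
    using u by (simp add: u_def)
qed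

text \<open>With t = x \<leadsto> 1, divisibility gives x t = x, so currying turns x \<leadsto> 1
  into t \<leadsto> t.\<close>

lemma imp_one:
  assumes x: "x \<in> carrier A"
  shows "x \<leadsto> \<one> = \<one>"
proof -
  have "x \<otimes> (x \<leadsto> \<one>) = x"
    using divisibility[of \<one> x] x by (simp add: one_imp)
  then have "x \<leadsto> \<one> = (x \<leadsto> \<one>) \<leadsto> (x \<leadsto> \<one>)"
    using imp_curry[of "x \<leadsto> \<one>" x \<one>] x by (simp add: m_comm)
  then show ?thesis
    using x by (simp add: imp_refl)
qed

section \<open>Order, residuation and infima\<close>

lemma le_refl: "x \<in> carrier A \<Longrightarrow> x \<preceq> x"
  by (simp add: hoop_le_def imp_refl)

lemma le_one: "x \<in> carrier A \<Longrightarrow> x \<preceq> \<one>"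
  by (simp add: hoop_le_def imp_one)

lemma le_antisym: "\<lbrakk>x \<preceq> y; y \<preceq> x; x \<in> carrier A; y \<in> carrier A\<rbrakk> \<Longrightarrow> x = y"
  using divisibility[of x y] by (simp add: hoop_le_def)

lemma le_trans:
  assumes "x \<preceq> y" "y \<preceq> z" and [simp]: "x \<in> carrier A" "y \<in> carrier A" "z \<in> carrier A"
  shows "x \<preceq> z"
proof -
  have "x = (y \<leadsto> x) \<otimes> y"
    using divisibility[of x y] assms by (simp add: hoop_le_def m_comm)
  then have "x \<leadsto> z = (y \<leadsto> x) \<leadsto> (y \<leadsto> z)"
    using imp_curry[of "y \<leadsto> x" y z] by simp
  then show ?thesis
    using assms by (simp add: hoop_le_def imp_one)
qed

lemma residuation:
  "\<lbrakk>x \<in> carrier A; y \<in> carrier A; z \<in> carrier A\<rbrakk> \<Longrightarrow> x \<otimes> y \<preceq> z \<longleftrightarrow> x \<preceq> y \<leadsto> z"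
  by (simp add: hoop_le_def imp_curry)

lemma imp_swap:
  "\<lbrakk>x \<in> carrier A; y \<in> carrier A; z \<in> carrier A\<rbrakk> \<Longrightarrow> x \<leadsto> (y \<leadsto> z) = y \<leadsto> (x \<leadsto> z)"
  by (metis imp_curry m_comm)

lemma mult_le_left: "\<lbrakk>x \<in> carrier A; y \<in> carrier A\<rbrakk> \<Longrightarrow> x \<otimes> y \<preceq> x"
  by (simp add: hoop_le_def imp_curry imp_swap[of x] imp_refl imp_one)

lemma mult_le_right: "\<lbrakk>x \<in> carrier A; y \<in> carrier A\<rbrakk> \<Longrightarrow> x \<otimes> y \<preceq> y"
  by (metis m_comm mult_le_left)

lemma mult_imp_le: "\<lbrakk>x \<in> carrier A; y \<in> carrier A\<rbrakk> \<Longrightarrow> x \<otimes> (x \<leadsto> y) \<preceq> y"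
  using mult_le_left[of y "y \<leadsto> x"] divisibility[of x y] by simp

lemma mult_imp_eq: "\<lbrakk>x \<preceq> y; x \<in> carrier A; y \<in> carrier A\<rbrakk> \<Longrightarrow> y \<otimes> (y \<leadsto> x) = x"
  using divisibility[of x y] by (simp add: hoop_le_def)

lemma mult_mono:
  assumes "x \<preceq> y" and [simp]: "x \<in> carrier A" "y \<in> carrier A" "z \<in> carrier A"
  shows "z \<otimes> x \<preceq> z \<otimes> y"
proof -
  have "z \<otimes> x = (z \<otimes> y) \<otimes> (y \<leadsto> x)"
    using mult_imp_eq[of x y] assms by (simp add: m_assoc)
  then show ?thesis
    by (simp add: mult_le_left)
qed

lemma mult_mono2:
  assumes "x \<preceq> y" "u \<preceq> v"
    and [simp]: "x \<in> carrier A" "y \<in> carrier A" "u \<in> carrier A" "v \<in> carrier A"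
  shows "x \<otimes> u \<preceq> y \<otimes> v"
  using le_trans[OF mult_mono[of u v x] mult_mono[of x y v, unfolded m_comm[OF assms(6,3)] m_comm[OF assms(6,4)]]]
    assms by simp

text \<open>If z is below both x and y, then z = x (x \<leadsto> z), and x \<leadsto> z is below x
  \<leadsto> y.\<close>

lemma le_inf_iff:
  assumes [simp]: "x \<in> carrier A" "y \<in> carrier A" "z \<in> carrier A"
  shows "z \<preceq> x \<otimes> (x \<leadsto> y) \<longleftrightarrow> z \<preceq> x \<and> z \<preceq> y"
proof
  assume "z \<preceq> x \<otimes> (x \<leadsto> y)"
  then show "z \<preceq> x \<and> z \<preceq> y"
    using le_trans mult_le_left[of x "x \<leadsto> y"] mult_imp_le[of x y] by (meson assms imp_closed m_closed)
next
  assume z: "z \<preceq> x \<and> z \<preceq> y"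
  have "x \<leadsto> z \<preceq> x \<leadsto> y"
    using le_trans[of "(x \<leadsto> z) \<otimes> x" z y] mult_imp_le[of x z] z
    by (simp add: m_comm flip: residuation)
  then show "z \<preceq> x \<otimes> (x \<leadsto> y)"
    using mult_mono[of "x \<leadsto> z" "x \<leadsto> y" x] mult_imp_eq[of z x] z by simp
qed

lemma eqI_le:
  assumes "x \<in> carrier A" "y \<in> carrier A" "\<And>z. z \<in> carrier A \<Longrightarrow> z \<preceq> x \<longleftrightarrow> z \<preceq> y"
  shows "x = y"
  using assms le_antisym le_refl by blast

text \<open>By residuation \<open>z \<leadsto> _\<close> is a right adjoint and so preserves infima:
  both sides have the same lower bounds.\<close>

lemma imp_inf:
  assumes [simp]: "x \<in> carrier A" "y \<in> carrier A" "z \<in> carrier A"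
  shows "z \<leadsto> x \<otimes> (x \<leadsto> y) = (z \<leadsto> x) \<otimes> ((z \<leadsto> x) \<leadsto> (z \<leadsto> y))"
  by (rule eqI_le) (simp_all add: le_inf_iff flip: residuation)

lemma imp_anti:
  assumes "x \<preceq> y" and [simp]: "x \<in> carrier A" "y \<in> carrier A" "z \<in> carrier A"
  shows "y \<leadsto> z \<preceq> x \<leadsto> z"
  using le_trans[OF mult_mono[of x y "y \<leadsto> z"] mult_imp_le[of y z, unfolded m_comm[of y "y \<leadsto> z", simplified]]] assms
  by (simp flip: residuation)

lemma le_imp_imp: "\<lbrakk>x \<in> carrier A; y \<in> carrier A\<rbrakk> \<Longrightarrow> x \<preceq> (x \<leadsto> y) \<leadsto> y"
  by (simp add: mult_imp_le flip: residuation)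

lemma le_imp: "\<lbrakk>x \<in> carrier A; y \<in> carrier A\<rbrakk> \<Longrightarrow> y \<preceq> x \<leadsto> y"
  by (simp add: mult_le_left flip: residuation)

lemma idempotent_mult:
  assumes "i \<otimes> i = i" "x \<preceq> i" and [simp]: "i \<in> carrier A" "x \<in> carrier A"
  shows "i \<otimes> x = x"
  using assms mult_imp_eq[of x i] by (metis imp_closed m_assoc)

section \<open>Minimal elements and least idempotents of finite sets\<close>

lemma strict_order_on:
  assumes "S \<subseteq> carrier A"
  shows "asymp_on S (\<lambda>x y. x \<preceq> y \<and> x \<noteq> y)" and "transp_on S (\<lambda>x y. x \<preceq> y \<and> x \<noteq> y)"
proof -
  show "asymp_on S (\<lambda>x y. x \<preceq> y \<and> x \<noteq> y)"
    using assms by (intro asymp_onI) (meson le_antisym subsetD)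
  show "transp_on S (\<lambda>x y. x \<preceq> y \<and> x \<noteq> y)"
  proof (rule transp_onI)
    fix x y z assume "x \<in> S" "y \<in> S" "z \<in> S" and le: "x \<preceq> y \<and> x \<noteq> y" "y \<preceq> z \<and> y \<noteq> z"
    then have "x \<in> carrier A" "y \<in> carrier A" "z \<in> carrier A"
      using assms by auto
    then show "x \<preceq> z \<and> x \<noteq> z"
      using le le_trans[of x y z] le_antisym[of x y] by auto
  qed
qed

lemma ex_minimal:
  assumes "S \<subseteq> carrier A" "finite S" "S \<noteq> {}"
  obtains m where "m \<in> S" "\<And>x. \<lbrakk>x \<in> S; x \<preceq> m\<rbrakk> \<Longrightarrow> x = m"
  using Finite_Set.bex_min_element[OF assms(2) strict_order_on[OF assms(1)] assms(3)] by blast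

lemma ex_maximal:
  assumes "S \<subseteq> carrier A" "finite S" "S \<noteq> {}"
  obtains m where "m \<in> S" "\<And>x. \<lbrakk>x \<in> S; m \<preceq> x\<rbrakk> \<Longrightarrow> x = m"
  using Finite_Set.bex_max_element[OF assms(2) strict_order_on[OF assms(1)] assms(3)] by blast

text \<open>For a minimal i, every product i x lies in S below i and so equals i. Taking x = i gives
  idempotence, and i = i x is below x.\<close>

lemma least_idempotent:
  assumes "finite S" "S \<noteq> {}" and sub: "S \<subseteq> carrier A"
    and closed: "\<And>x y. \<lbrakk>x \<in> S; y \<in> S\<rbrakk> \<Longrightarrow> x \<otimes> y \<in> S"
  obtains i where "i \<in> S" "i \<otimes> i = i" "\<And>x. x \<in> S \<Longrightarrow> i \<preceq> x"
proof -
  obtain i where i: "i \<in> S" "\<And>x. \<lbrakk>x \<in> S; x \<preceq> i\<rbrakk> \<Longrightarrow> x = i"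
    using ex_minimal[OF sub assms(1,2)] by blast
  have mult: "i \<otimes> x = i" and "i \<preceq> x" if "x \<in> S" for x
  proof -
    have [simp]: "i \<in> carrier A" "x \<in> carrier A"
      using that i(1) sub by auto
    show "i \<otimes> x = i"
      using i(2)[OF closed[OF i(1) that]] by (simp add: mult_le_left)
    then show "i \<preceq> x"
      using mult_le_right[of i x] by simp
  qed
  then show thesis
    using that i(1) by simp
qed

lemma least_element:
  assumes "finite (carrier A)"
  obtains z where "z \<in> carrier A" "\<And>x. x \<in> carrier A \<Longrightarrow> z \<preceq> x"
proof -
  have "carrier A \<noteq> {}"
    using one_closed by blast
  then show thesis
  proof (rule least_idempotent[OF assms _ subset_refl m_closed])
    fix z assume "z \<in> carrier A" "\<And>x. x \<in> carrier A \<Longrightarrow> z \<preceq> x"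
    then show thesis
      by (rule that)
  qed
qed

lemma hoop_subalgebra:
  assumes "S \<subseteq> carrier A" "\<one> \<in> S"
    and "\<And>x y. \<lbrakk>x \<in> S; y \<in> S\<rbrakk> \<Longrightarrow> x \<otimes> y \<in> S"
    and "\<And>x y. \<lbrakk>x \<in> S; y \<in> S\<rbrakk> \<Longrightarrow> x \<leadsto> y \<in> S"
  shows "hoop (A\<lparr>carrier := S\<rparr>)"
  by unfold_locales
    (use assms in \<open>auto simp: subset_iff m_assoc imp_refl imp_curry divisibility intro: m_comm\<close>)

end


section \<open>Isomorphisms\<close>

lemma hoop_isoD:
  assumes "h \<in> hoop_iso A B"
  shows "bij_betw h (carrier A) (carrier B)"
    and "h \<one>\<^bsub>A\<^esub> = \<one>\<^bsub>B\<^esub>"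
    and "\<lbrakk>x \<in> carrier A; y \<in> carrier A\<rbrakk> \<Longrightarrow> h (x \<otimes>\<^bsub>A\<^esub> y) = h x \<otimes>\<^bsub>B\<^esub> h y"
    and "\<lbrakk>x \<in> carrier A; y \<in> carrier A\<rbrakk> \<Longrightarrow> h (x \<leadsto>\<^bsub>A\<^esub> y) = h x \<leadsto>\<^bsub>B\<^esub> h y"
  using assms by (auto simp: hoop_iso_def iso_def hom_def)

lemma hoop_isoI:
  assumes "bij_betw h (carrier A) (carrier B)"
    and "h \<one>\<^bsub>A\<^esub> = \<one>\<^bsub>B\<^esub>"
    and "\<And>x y. \<lbrakk>x \<in> carrier A; y \<in> carrier A\<rbrakk> \<Longrightarrow> h (x \<otimes>\<^bsub>A\<^esub> y) = h x \<otimes>\<^bsub>B\<^esub> h y"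
    and "\<And>x y. \<lbrakk>x \<in> carrier A; y \<in> carrier A\<rbrakk> \<Longrightarrow> h (x \<leadsto>\<^bsub>A\<^esub> y) = h x \<leadsto>\<^bsub>B\<^esub> h y"
  shows "h \<in> hoop_iso A B"
  using assms by (auto simp: hoop_iso_def iso_def hom_def bij_betw_apply)

lemma hoop_iso_comp:
  assumes "h \<in> hoop_iso A B" "k \<in> hoop_iso B C"
  shows "k \<circ> h \<in> hoop_iso A C"
proof -
  note hD = hoop_isoD[OF assms(1)] and kD = hoop_isoD[OF assms(2)]
  show ?thesis
    by (rule hoop_isoI)
      (auto intro: bij_betw_trans[OF hD(1) kD(1)] simp: hD(2-4) kD(2-4) bij_betw_apply[OF hD(1)])
qed

text \<open>Closure stands in place of the hoop laws for A, because the lemma is applied to an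
  f-product, which is recognised as a hoop only afterwards, through the isomorphism.\<close>

lemma hoop_iso_inv:
  assumes "h \<in> hoop_iso A B" "\<one>\<^bsub>A\<^esub> \<in> carrier A"
    and "\<And>x y. \<lbrakk>x \<in> carrier A; y \<in> carrier A\<rbrakk> \<Longrightarrow> x \<otimes>\<^bsub>A\<^esub> y \<in> carrier A"
    and "\<And>x y. \<lbrakk>x \<in> carrier A; y \<in> carrier A\<rbrakk> \<Longrightarrow> x \<leadsto>\<^bsub>A\<^esub> y \<in> carrier A"
  shows "inv_into (carrier A) h \<in> hoop_iso B A"
proof -
  note hD = hoop_isoD[OF assms(1)]
  have inj: "inj_on h (carrier A)" and img: "carrier B = h ` carrier A"
    using hD(1) by (auto simp: bij_betw_def)
  show ?thesis
    by (rule hoop_isoI)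
      (auto simp: bij_betw_inv_into[OF hD(1), unfolded img] img inj assms(2-4)
        hD(3,4)[symmetric] hD(2)[symmetric])
qed

lemma hoop_isomorphic_trans:
  "\<lbrakk>hoop_isomorphic A B; hoop_isomorphic B C\<rbrakk> \<Longrightarrow> hoop_isomorphic A C"
  using hoop_iso_comp unfolding hoop_isomorphic_def by blast

lemma hoop_iso_hoop:
  assumes "hoop A" "h \<in> hoop_iso A B"
  shows "hoop B"
proof -
  interpret hoop A by fact
  note hD = hoop_isoD[OF assms(2)]
  have img: "carrier B = h ` carrier A"
    using hD(1) by (auto simp: bij_betw_def)
  show ?thesis
    by unfold_locales
      (auto simp: img hD(3,4)[symmetric] hD(2)[symmetric] imp_refl m_assoc imp_curry divisibility intro!: arg_cong[where f = h] intro: m_comm)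
qed

lemma hoop_isomorphic_hoop: "\<lbrakk>hoop A; hoop_isomorphic A B\<rbrakk> \<Longrightarrow> hoop B"
  using hoop_iso_hoop unfolding hoop_isomorphic_def by blast

lemma hoop_isomorphic_copy:
  "\<lbrakk>hoop A; inj_on h (carrier A)\<rbrakk> \<Longrightarrow> hoop_isomorphic A (hoop_copy h A)"
  using hoop_copy_iso unfolding hoop_isomorphic_def by blast

text \<open>Conjugating f by isomorphisms of the factors lets the factors of a splitting be replaced
  by nested products.\<close>

lemma product_morphism_iso:
  assumes "hoop B" "hoop C" "product_morphism C B f" and h: "h \<in> hoop_iso B B'" and k: "k \<in> hoop_iso C C'"
  defines "f' \<equiv> h \<circ> f \<circ> inv_into (carrier C) k"
  shows "product_morphism C' B' f'"
    and "(\<lambda>(b, x). (h b, k x)) \<in> hoop_iso (f_product f B C) (f_product f' B' C')"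
proof -
  interpret B: hoop B by fact
  interpret C: hoop C by fact
  note hD = hoop_isoD[OF h] and kD = hoop_isoD[OF k]
  have img: "carrier B' = h ` carrier B" "carrier C' = k ` carrier C"
    and inj: "inj_on h (carrier B)" "inj_on k (carrier C)"
    using hD(1) kD(1) by (auto simp: bij_betw_def)
  have f [simp]: "f x \<in> carrier B" if "x \<in> carrier C" for x
    using assms(3) that by (auto simp: product_morphism_def)
  have f' [simp]: "f' (k x) = h (f x)" if "x \<in> carrier C" for x
    using that inj by (simp add: f'_def)
  have inf_h: "hoop_inf B' (h x) (h y) = h (hoop_inf B x y)"
    if "x \<in> carrier B" "y \<in> carrier B" for x y
    using that by (simp add: hoop_inf_def hD(3,4))
  have inf_k: "hoop_inf C' (k x) (k y) = k (hoop_inf C x y)"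
    if "x \<in> carrier C" "y \<in> carrier C" for x y
    using that by (simp add: hoop_inf_def kD(3,4))
  have inf_closed [simp]: "x \<in> carrier B \<Longrightarrow> y \<in> carrier B \<Longrightarrow> hoop_inf B x y \<in> carrier B"
    "u \<in> carrier C \<Longrightarrow> v \<in> carrier C \<Longrightarrow> hoop_inf C u v \<in> carrier C" for x y u v
    by (simp_all add: hoop_inf_def)
  \<comment> \<open>Injectivity makes h reflect the order, so that the carrier condition b \<le>
    f(x) carries over in both directions.\<close>
  have le_h: "hoop_le B' (h x) (h y) \<longleftrightarrow> hoop_le B x y"
    if "x \<in> carrier B" "y \<in> carrier B" for x y
    using that inj_on_eq_iff[OF inj(1), of "x \<leadsto>\<^bsub>B\<^esub> y" "\<one>\<^bsub>B\<^esub>"]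
    by (simp add: hoop_le_def hD(4)[symmetric] hD(2)[symmetric])
  show "product_morphism C' B' f'"
    unfolding product_morphism_def img
    using assms(3)
    by (auto simp: product_morphism_def hD(3)[symmetric] kD(3)[symmetric] kD(2)[symmetric] inf_h inf_k)
      (simp_all add: hD(2))
  show "(\<lambda>(b, x). (h b, k x)) \<in> hoop_iso (f_product f B C) (f_product f' B' C')"
  proof (rule hoop_isoI)
    show "bij_betw (\<lambda>(b, x). (h b, k x)) (carrier (f_product f B C)) (carrier (f_product f' B' C'))"
      unfolding bij_betw_def
    proof
      show "inj_on (\<lambda>(b, x). (h b, k x)) (carrier (f_product f B C))"
        using inj by (auto simp: f_product_def inj_on_def)
      show "(\<lambda>(b, x). (h b, k x)) ` carrier (f_product f B C) = carrier (f_product f' B' C')"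
        by (force simp: f_product_def img le_h image_iff)
    qed
  qed (auto simp: f_product_def hD(2-4) kD(2) kD(3,4)[symmetric] inf_h[symmetric])
qed

text \<open>The inductive step common to both decompositions.\<close>

lemma nested_product_isomorphic:
  assumes "hoop A" "hoop B" "hoop C" "product_morphism C B f"
    and A: "hoop_isomorphic A (f_product f B C)"
    and iso: "hoop_isomorphic B B'" "hoop_isomorphic C C'"
  obtains f' where "product_morphism C' B' f'" "hoop_isomorphic A (nested_product f' B' C')"
proof -
  obtain h k where hk: "h \<in> hoop_iso B B'" "k \<in> hoop_iso C C'"
    using iso unfolding hoop_isomorphic_def by blast
  define f' where "f' = h \<circ> f \<circ> inv_into (carrier C) k"
  note f' = product_morphism_iso[OF assms(2-4) hk, folded f'_def]
  have A': "hoop_isomorphic A (f_product f' B' C')"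
    using hoop_isomorphic_trans[OF A] f'(2) unfolding hoop_isomorphic_def by blast
  \<comment> \<open>Copying needs the hoop laws for the f-product; they are inherited from A along
    the isomorphism.\<close>
  have "hoop_isomorphic (f_product f' B' C') (nested_product f' B' C')"
    unfolding nested_product_def
    by (rule hoop_isomorphic_copy[OF hoop_isomorphic_hoop[OF \<open>hoop A\<close> A']]) (auto intro: inj_onI)
  then show thesis
    using that f'(1) hoop_isomorphic_trans[OF A'] by blast
qed


section \<open>Splitting a finite hoop at an idempotent\<close>

locale hoop_idempotent = hoop +
  fixes e
  assumes finite_carrier: "finite (carrier A)"
    and e_closed [simp]: "e \<in> carrier A"
    and e_idem: "e \<otimes> e = e"
begin

definition "filt = {b \<in> carrier A. e \<preceq> b}"
definition "quot = {x \<in> carrier A. e \<leadsto> x = x}"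

text \<open>A representative system for the quotient by \<^term>\<open>filt\<close>: every class has the greatest
  element \<^term>\<open>e \<leadsto> x\<close>. These elements turn out to be closed under the operations.\<close>

abbreviation "Filt \<equiv> A\<lparr>carrier := filt\<rparr>"
abbreviation "Quot \<equiv> A\<lparr>carrier := quot\<rparr>"

lemma filt_carrier [simp]: "b \<in> filt \<Longrightarrow> b \<in> carrier A"
  and quot_carrier [simp]: "x \<in> quot \<Longrightarrow> x \<in> carrier A"
  by (auto simp: filt_def quot_def)

lemma filt_le: "b \<in> filt \<Longrightarrow> e \<preceq> b"
  and quot_fixed: "x \<in> quot \<Longrightarrow> e \<leadsto> x = x"
  by (auto simp only: filt_def quot_def)

lemma filt_mult [simp]:
  assumes "a \<in> filt" "b \<in> filt"
  shows "a \<otimes> b \<in> filt"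
proof -
  have [simp]: "a \<in> carrier A" "b \<in> carrier A" and "e \<preceq> a" "e \<preceq> b"
    using assms by (simp_all add: filt_le)
  have "e \<preceq> a \<otimes> e"
    using mult_mono[OF \<open>e \<preceq> a\<close>, of e] m_comm[of a e] e_idem by simp
  then have "e \<preceq> a \<otimes> b"
    using le_trans[OF _ mult_mono[OF \<open>e \<preceq> b\<close>, of a]] by simp
  then show ?thesis
    unfolding filt_def by simp
qed

lemma filt_up: "\<lbrakk>b \<in> filt; b \<preceq> c; c \<in> carrier A\<rbrakk> \<Longrightarrow> c \<in> filt"
  using le_trans[of e b c] unfolding filt_def by auto

lemma filt_imp [simp]: "\<lbrakk>x \<in> carrier A; b \<in> filt\<rbrakk> \<Longrightarrow> x \<leadsto> b \<in> filt"
  using filt_up le_imp by simp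

lemma filt_one [simp]: "\<one> \<in> filt"
  unfolding filt_def by (simp add: le_one)

lemma quot_one [simp]: "\<one> \<in> quot"
  unfolding quot_def by (simp add: imp_one)

lemma quot_imp [simp]: "\<lbrakk>x \<in> carrier A; y \<in> quot\<rbrakk> \<Longrightarrow> x \<leadsto> y \<in> quot"
  unfolding quot_def by (simp add: imp_swap[of e x])

lemma e_imp_quot [simp]: "x \<in> carrier A \<Longrightarrow> e \<leadsto> x \<in> quot"
  using imp_curry[of e e x] unfolding quot_def by (simp add: e_idem)

text \<open>Since e \<preceq> b and e is idempotent, b e = e; so b \<leadsto> (e \<leadsto> x)
  curries to e \<leadsto> x.\<close>

lemma filt_imp_quot:
  assumes "b \<in> filt" "x \<in> quot"
  shows "b \<leadsto> x = x"
proof -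
  have [simp]: "b \<in> carrier A" "x \<in> carrier A" and "e \<preceq> b" and x: "e \<leadsto> x = x"
    using assms by (simp_all add: filt_le quot_fixed)
  have "e \<preceq> b \<otimes> e"
    using mult_mono[OF \<open>e \<preceq> b\<close>, of e] m_comm[of b e] e_idem by simp
  then have "b \<otimes> e = e"
    by (intro le_antisym) (simp_all add: mult_le_right)
  then show ?thesis
    using imp_curry[of b e x] x by simp
qed

text \<open>As b \<leadsto> x = x, the product b x is the infimum of b and x, which makes
  \<open>imp_inf\<close> applicable to such products.\<close>

lemma mult_filt_quot: "\<lbrakk>b \<in> filt; x \<in> quot\<rbrakk> \<Longrightarrow> b \<otimes> x = x \<otimes> (x \<leadsto> b)"
  using divisibility[of b x] by (simp add: filt_imp_quot)

lemma mult_filt_quot_absorb: "\<lbrakk>b \<in> filt; x \<in> quot; x \<preceq> b\<rbrakk> \<Longrightarrow> b \<otimes> x = x"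
  using mult_imp_eq[of x b] by (simp add: filt_imp_quot)

lemma filt_classes: "x \<in> carrier A \<Longrightarrow> (e \<leadsto> x) \<leadsto> x \<in> filt"
  using le_imp_imp[of e x] unfolding filt_def by simp

text \<open>The greatest element m of the class of x y is shown to equal x y. One has m c = x y with
  c in \<open>filt\<close>, and m absorbs the elements of \<open>filt\<close> above it, so m
  \<preceq> c suffices.\<close>

lemma quot_mult [simp]:
  assumes [simp]: "x \<in> quot" "y \<in> quot"
  shows "x \<otimes> y \<in> quot"
proof -
  define m c where "m = e \<leadsto> x \<otimes> y" and "c = m \<leadsto> x \<otimes> y"
  have mq [simp]: "m \<in> quot" and cF [simp]: "c \<in> filt"
    by (simp_all add: m_def c_def filt_classes)
  have xy_m: "x \<otimes> y \<preceq> m"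
    by (simp add: m_def le_imp)
  have mc: "m \<otimes> c = x \<otimes> y"
    using mult_imp_eq[OF xy_m] by (simp add: c_def)
  \<comment> \<open>Thus m is the least element of \<open>quot\<close> above x y; in particular it
    is below x and y.\<close>
  have m_le: "m \<preceq> z" if "x \<otimes> y \<preceq> z" "z \<in> quot" for z
  proof -
    have "e \<leadsto> x \<otimes> y \<preceq> e \<leadsto> z"
      using that le_trans[OF mult_imp_le[of e "x \<otimes> y"], of z] by (simp add: m_comm flip: residuation)
    then show ?thesis
      using that unfolding quot_def by (simp add: m_def)
  qed
  have "m \<preceq> x" "m \<preceq> y"
    by (simp_all add: m_le mult_le_left mult_le_right)
  have "x \<otimes> y \<preceq> c"
    by (simp add: c_def le_imp)
  \<comment> \<open>Residuation, used to replace first x and then y by m, turns x y \<preceq> c into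
    m \<preceq> m \<leadsto> c.\<close>
  then have "m \<preceq> y \<leadsto> c"
    using le_trans[of m x "y \<leadsto> c"] \<open>m \<preceq> x\<close> by (simp add: residuation)
  then have "y \<preceq> m \<leadsto> c"
    by (simp add: m_comm flip: residuation)
  then have "m \<preceq> m \<leadsto> c"
    using le_trans[of m y "m \<leadsto> c"] \<open>m \<preceq> y\<close> by simp
  then have "m \<otimes> (m \<leadsto> c) = m"
    using mult_filt_quot_absorb[of "m \<leadsto> c" m] by (simp add: m_comm)
  then have "m \<preceq> c"
    using mult_imp_le[of m c] by simp
  then have "m \<otimes> c = m"
    using mult_filt_quot_absorb[of c m] by (simp add: m_comm)
  then show ?thesis
    using mc mq by simp
qed

lemma hoop_Filt: "hoop Filt" and hoop_Quot: "hoop Quot"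
  by (rule hoop_subalgebra; auto)+

section \<open>Covers in the filter and the product morphism\<close>

definition cover where
  "cover x = (SOME b. b \<in> filt \<and> x \<preceq> b \<and> b \<otimes> b = b \<and> (\<forall>c\<in>filt. x \<preceq> c \<longrightarrow> b \<preceq> c))"

text \<open>The elements of \<open>filt\<close> above x are closed under products, because x absorbs
  each of them; so they have a least element, and it is idempotent.\<close>

lemma cover:
  assumes x: "x \<in> quot"
  shows cover_filt [simp]: "cover x \<in> filt"
    and le_cover: "x \<preceq> cover x"
    and cover_idem: "cover x \<otimes> cover x = cover x"
    and cover_le: "\<lbrakk>c \<in> filt; x \<preceq> c\<rbrakk> \<Longrightarrow> cover x \<preceq> c"
proof -
  let ?S = "{b \<in> filt. x \<preceq> b}"
  have fin: "finite ?S"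
    by (rule finite_subset[OF _ finite_carrier]) auto
  have ne: "?S \<noteq> {}"
    using x le_one filt_one quot_carrier by blast
  have closed: "a \<otimes> b \<in> ?S" if "a \<in> ?S" "b \<in> ?S" for a b
    using that mult_mono[of x b a] mult_filt_quot_absorb[of a x] x by simp
  have sub: "?S \<subseteq> carrier A"
    by auto
  obtain i where "i \<in> ?S" "i \<otimes> i = i" "\<And>b. b \<in> ?S \<Longrightarrow> i \<preceq> b"
    using least_idempotent[OF fin ne sub closed] by blast
  then have "\<exists>b. b \<in> filt \<and> x \<preceq> b \<and> b \<otimes> b = b \<and> (\<forall>c\<in>filt. x \<preceq> c \<longrightarrow> b \<preceq> c)"
    by blast
  from someI_ex[OF this, folded cover_def]
  show "cover x \<in> filt" "x \<preceq> cover x" "cover x \<otimes> cover x = cover x"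
    "\<lbrakk>c \<in> filt; x \<preceq> c\<rbrakk> \<Longrightarrow> cover x \<preceq> c"
    by blast+
qed

text \<open>Since \<^term>\<open>x \<preceq> (x \<leadsto> b) \<leadsto> b\<close> and the right-hand side lies in \<^term>\<open>filt\<close>, it is above
  the cover of \<^term>\<open>x\<close>: elements of \<^term>\<open>filt\<close> cannot tell \<^term>\<open>x\<close> from its cover.\<close>

lemma imp_filt_cover:
  assumes [simp]: "x \<in> quot" "b \<in> filt"
  shows "x \<leadsto> b = cover x \<leadsto> b"
proof (rule le_antisym)
  have "cover x \<preceq> (x \<leadsto> b) \<leadsto> b"
    by (simp add: cover_le le_imp_imp)
  then show "x \<leadsto> b \<preceq> cover x \<leadsto> b"
    by (simp add: m_comm flip: residuation)
  show "cover x \<leadsto> b \<preceq> x \<leadsto> b"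
    by (simp add: imp_anti le_cover)
qed simp_all

lemma cover_mono: "\<lbrakk>x \<preceq> y; x \<in> quot; y \<in> quot\<rbrakk> \<Longrightarrow> cover x \<preceq> cover y"
  using le_trans[OF _ le_cover] by (simp add: cover_le)

lemma cover_one: "cover \<one> = \<one>"
  by (rule le_antisym) (simp_all add: le_one le_cover)

text \<open>For the harder inequality, x is below y \<leadsto> cover (x y), where y may be replaced
  by its cover. The result lies in \<open>filt\<close>, so it is also above cover x.\<close>

lemma cover_mult:
  assumes [simp]: "x \<in> quot" "y \<in> quot"
  shows "cover (x \<otimes> y) = cover x \<otimes> cover y"
proof (rule le_antisym)
  have "x \<otimes> y \<preceq> cover x \<otimes> cover y"
    by (simp add: mult_mono2 le_cover)
  then show "cover (x \<otimes> y) \<preceq> cover x \<otimes> cover y"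
    by (simp add: cover_le)
  have "x \<preceq> y \<leadsto> cover (x \<otimes> y)"
    by (simp add: le_cover flip: residuation)
  then have "cover x \<preceq> cover y \<leadsto> cover (x \<otimes> y)"
    by (simp add: cover_le imp_filt_cover[of y])
  then show "cover x \<otimes> cover y \<preceq> cover (x \<otimes> y)"
    by (simp add: residuation)
qed simp_all

text \<open>Covers are idempotent, so their product is their infimum. The cover of the infimum of x
  and y is squeezed: it is above cover (x y), which is that product, and below both covers.\<close>

lemma product_morphism_cover: "product_morphism Quot Filt cover"
proof -
  have "cover x \<otimes> (cover x \<leadsto> cover y) = cover x \<otimes> cover y"
    and "cover (x \<otimes> (x \<leadsto> y)) = cover x \<otimes> cover y" if [simp]: "x \<in> quot" "y \<in> quot" for x y
  proof -
    have le: "z \<preceq> cover x \<otimes> cover y" if [simp]: "z \<in> carrier A" and z: "z \<preceq> cover x" "z \<preceq> cover y" for z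
    proof -
      have "cover x \<otimes> z = z"
        using z by (simp add: idempotent_mult cover_idem)
      then show ?thesis
        using z(2) mult_mono[of z "cover y" "cover x"] by simp
    qed
    show "cover x \<otimes> (cover x \<leadsto> cover y) = cover x \<otimes> cover y"
      by (rule le_antisym) (simp_all add: le mult_le_left mult_imp_le le_inf_iff mult_le_right)
    have "cover x \<otimes> cover y \<preceq> cover (x \<otimes> (x \<leadsto> y))"
      by (simp add: cover_mult[symmetric] cover_mono le_inf_iff mult_le_left mult_le_right)
    then show "cover (x \<otimes> (x \<leadsto> y)) = cover x \<otimes> cover y"
      by (intro le_antisym le) (simp_all add: cover_mono mult_le_left mult_imp_le)
  qed
  then show ?thesis
    by (simp add: product_morphism_def hoop_inf_def cover_mult cover_one)
qed

section \<open>Multiplication as an isomorphism from the f-product\<close>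

lemma imp_pair:
  assumes [simp]: "a \<in> filt" "b \<in> filt" "x \<in> quot" "y \<in> quot" and "a \<preceq> cover x"
  shows "(a \<otimes> x) \<leadsto> (b \<otimes> y) = (cover (x \<leadsto> y) \<otimes> (cover (x \<leadsto> y) \<leadsto> (a \<leadsto> b))) \<otimes> (x \<leadsto> y)"
proof -
  have 1: "(a \<otimes> x) \<leadsto> y = x \<leadsto> y"
    by (simp add: imp_curry filt_imp_quot)
  \<comment> \<open>Here the carrier condition on (a, x) enters: a absorbs the cover of x, so x
    disappears from the antecedent.\<close>
  have "a \<otimes> cover x = a"
    using idempotent_mult[OF cover_idem, of x a] assms(5) by (simp add: m_comm)
  then have 2: "(a \<otimes> x) \<leadsto> b = a \<leadsto> b"
    using imp_curry[of a x b] imp_curry[of a "cover x" b] by (simp add: imp_filt_cover)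
  \<comment> \<open>The product b y is the infimum of y and b, and implication preserves infima in
    its second argument.\<close>
  have "(a \<otimes> x) \<leadsto> (b \<otimes> y) = (x \<leadsto> y) \<otimes> ((x \<leadsto> y) \<leadsto> (a \<leadsto> b))"
    using imp_inf[of y b "a \<otimes> x"] by (simp add: mult_filt_quot[of b y] 1 2)
  \<comment> \<open>The cover of x \<leadsto> y appears twice: as a factor absorbed by x \<leadsto>
    y, and as its replacement in front of a \<leadsto> b, which lies in \<open>filt\<close>.\<close>
  also have "\<dots> = (cover (x \<leadsto> y) \<otimes> (x \<leadsto> y)) \<otimes> (cover (x \<leadsto> y) \<leadsto> (a \<leadsto> b))"
    by (simp add: mult_filt_quot_absorb le_cover imp_filt_cover[of "x \<leadsto> y"])
  finally show ?thesis
    by (simp add: m_ac)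
qed

lemma iso_f_product: "(\<lambda>(b, x). b \<otimes> x) \<in> hoop_iso (f_product cover Filt Quot) A"
proof (rule hoop_isoI)
  have e_imp: "e \<leadsto> b \<otimes> x = x" if [simp]: "b \<in> filt" "x \<in> quot" for b x
  proof -
    have "e \<leadsto> b \<otimes> x = (e \<leadsto> x) \<otimes> ((e \<leadsto> x) \<leadsto> (e \<leadsto> b))"
      using imp_inf[of x b e] mult_filt_quot[OF that] by simp
    also have "\<dots> = x"
      using filt_le[of b] by (simp add: quot_fixed hoop_le_def imp_one)
    finally show ?thesis .
  qed
  have fst: "cover x \<otimes> (x \<leadsto> b \<otimes> x) = b" if [simp]: "b \<in> filt" "x \<in> quot" and "b \<preceq> cover x" for b x
  proof -
    have "x \<leadsto> b \<otimes> x = x \<leadsto> b"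
      using imp_inf[of x b x] mult_filt_quot[OF that(1,2)] by (simp add: imp_refl one_imp)
    also have "\<dots> = cover x \<leadsto> b"
      by (rule imp_filt_cover) simp_all
    finally have "x \<leadsto> b \<otimes> x = cover x \<leadsto> b" .
    then show ?thesis
      using mult_imp_eq[OF that(3)] by simp
  qed
  show "bij_betw (\<lambda>(b, x). b \<otimes> x) (carrier (f_product cover Filt Quot)) (carrier A)"
  \<comment> \<open>The second component of the inverse is x = e \<leadsto> a; the first is x
    \<leadsto> a, cut down by the cover of x to meet the carrier condition.\<close>
  proof (rule bij_betw_byWitness[where
        f' = "\<lambda>a. (cover (e \<leadsto> a) \<otimes> ((e \<leadsto> a) \<leadsto> a), e \<leadsto> a)"])
    show "\<forall>a\<in>carrier A. (case (cover (e \<leadsto> a) \<otimes> ((e \<leadsto> a) \<leadsto> a), e \<leadsto> a) of (b, x) \<Rightarrow> b \<otimes> x) = a"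
    proof
      fix a assume [simp]: "a \<in> carrier A"
      let ?m = "e \<leadsto> a"
      have "(cover ?m \<otimes> (?m \<leadsto> a)) \<otimes> ?m = (cover ?m \<otimes> ?m) \<otimes> (?m \<leadsto> a)"
        by (simp add: m_ac)
      also have "\<dots> = a"
        by (simp add: mult_filt_quot_absorb le_cover mult_imp_eq le_imp)
      finally show "(case (cover ?m \<otimes> (?m \<leadsto> a), ?m) of (b, x) \<Rightarrow> b \<otimes> x) = a"
        by simp
    qed
  qed (auto simp: f_product_def hoop_le_def[of Filt] hoop_le_def[of A, symmetric] e_imp fst
      filt_classes mult_le_left)
qed (auto simp: f_product_def hoop_le_def[of Filt] hoop_le_def[of A, symmetric] hoop_inf_def
    imp_pair m_ac)

lemma isomorphic_f_product: "hoop_isomorphic A (f_product cover Filt Quot)"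
proof -
  let ?P = "f_product cover Filt Quot"
  have carrier: "carrier ?P = {(b, x). b \<in> filt \<and> x \<in> quot \<and> b \<preceq> cover x}"
    by (simp add: f_product_def hoop_le_def)
  have "a \<otimes> b \<preceq> cover x \<otimes> cover y"
    if [simp]: "a \<in> filt" "b \<in> filt" "x \<in> quot" "y \<in> quot"
      and le: "a \<preceq> cover x" "b \<preceq> cover y" for a b x y
    using le by (simp add: mult_mono2)
  then have "inv_into (carrier ?P) (\<lambda>(b, x). b \<otimes> x) \<in> hoop_iso A ?P"
    by (intro hoop_iso_inv[OF iso_f_product])
      (auto simp: carrier, auto simp: f_product_def hoop_inf_def cover_mult mult_le_left le_cover)
  then show ?thesis
    unfolding hoop_isomorphic_def by blast
qed

end

section \<open>Simple finite hoops are MV-chains\<close>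

text \<open>Every filter of a finite hoop is the up-set of an idempotent, so for finite hoops this
  says that there are no filters besides {1} and the whole hoop. The one-element hoop counts as
  simple.\<close>

definition simple_hoop :: "('a, 'm) hoop_sig_scheme \<Rightarrow> bool" where
  "simple_hoop A \<longleftrightarrow> (\<forall>i\<in>carrier A. i \<otimes>\<^bsub>A\<^esub> i = i \<longrightarrow>
     i = \<one>\<^bsub>A\<^esub> \<or> (\<forall>x\<in>carrier A. hoop_le A i x))"

lemma simple_hoop_iso:
  assumes "hoop A" "h \<in> hoop_iso A B" "simple_hoop A"
  shows "simple_hoop B"
proof -
  interpret hoop A by fact
  note hD = hoop_isoD[OF assms(2)]
  have inj: "inj_on h (carrier A)" and img: "carrier B = h ` carrier A"
    using hD(1) by (auto simp: bij_betw_def)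
  show ?thesis
    unfolding simple_hoop_def img
  proof (intro ballI impI, elim imageE, hypsubst)
    fix i assume i: "i \<in> carrier A" "h i \<otimes>\<^bsub>B\<^esub> h i = h i"
    then have "i \<otimes>\<^bsub>A\<^esub> i = i"
      using inj_on_eq_iff[OF inj, of "i \<otimes>\<^bsub>A\<^esub> i" i] by (simp add: hD(3))
    then have "i = \<one>\<^bsub>A\<^esub> \<or> (\<forall>x\<in>carrier A. i \<leadsto>\<^bsub>A\<^esub> x = \<one>\<^bsub>A\<^esub>)"
      using assms(3) i(1) by (auto simp: simple_hoop_def hoop_le_def)
    then show "h i = \<one>\<^bsub>B\<^esub> \<or> (\<forall>x\<in>h ` carrier A. hoop_le B (h i) x)"
      using i(1) by (auto simp: hoop_le_def hD(4)[symmetric] hD(2)[symmetric])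
  qed
qed

locale finite_simple_hoop = hoop +
  assumes finite_carrier: "finite (carrier A)"
    and simple: "simple_hoop A"
begin

text \<open>The elements \<^term>\<open>v\<close> with \<^term>\<open>v \<leadsto> b = b\<close> have a least element, which is idempotent.\<close>

lemma imp_fixed:
  assumes "u \<leadsto> b = b" and [simp]: "u \<in> carrier A" "b \<in> carrier A"
  shows "u = \<one> \<or> b = \<one>"
proof -
  let ?S = "{v \<in> carrier A. v \<leadsto> b = b}"
  obtain i where i: "i \<in> ?S" "i \<otimes> i = i" "\<And>v. v \<in> ?S \<Longrightarrow> i \<preceq> v"
  proof (rule least_idempotent[of ?S])
    show "finite ?S"
      using finite_carrier by simp
    show "?S \<noteq> {}"
      using assms by blast
  qed (auto simp: imp_curry)
  then consider "i = \<one>" | "i \<leadsto> b = \<one>"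
    using simple by (auto simp: simple_hoop_def hoop_le_def)
  then show ?thesis
  proof cases
    case 1
    then have "\<one> \<preceq> u"
      using i(3)[of u] assms by simp
    then show ?thesis
      using le_antisym[OF le_one] by simp
  next
    case 2
    then show ?thesis
      using i(1) by simp
  qed
qed

text \<open>For z = (x \<leadsto> y) \<leadsto> y one has x \<preceq> z and z \<leadsto> y = x
  \<leadsto> y. Hence z \<leadsto> x fixes x \<leadsto> y, and \<open>imp_fixed\<close> leaves z
  \<preceq> x or x \<preceq> y.\<close>

lemma imp_imp_eq:
  assumes "y \<preceq> x" and [simp]: "x \<in> carrier A" "y \<in> carrier A"
  shows "(x \<leadsto> y) \<leadsto> y = x"
proof -
  define z where "z = (x \<leadsto> y) \<leadsto> y"
  have [simp]: "z \<in> carrier A" and xz: "x \<preceq> z"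
    by (simp_all add: z_def le_imp_imp)
  have zy: "z \<leadsto> y = x \<leadsto> y"
  proof (rule le_antisym)
    show "z \<leadsto> y \<preceq> x \<leadsto> y"
      by (simp add: imp_anti xz)
    show "x \<leadsto> y \<preceq> z \<leadsto> y"
      unfolding z_def by (simp add: le_imp_imp)
  qed simp_all
  have "(z \<leadsto> x) \<leadsto> (x \<leadsto> y) = z \<otimes> (z \<leadsto> x) \<leadsto> y"
    using imp_curry[of "z \<leadsto> x" z y] by (simp add: zy m_comm)
  also have "\<dots> = x \<leadsto> y"
    by (simp add: mult_imp_eq xz)
  finally consider "z \<leadsto> x = \<one>" | "x \<leadsto> y = \<one>"
    using imp_fixed[of "z \<leadsto> x" "x \<leadsto> y"] by auto
  then show ?thesis
  proof cases
    case 1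
    then show ?thesis
      using le_antisym[OF _ xz] by (simp add: hoop_le_def z_def)
  next
    case 2
    then have "x = y"
      using le_antisym[OF _ assms(1)] by (simp add: hoop_le_def)
    then show ?thesis
      by (simp add: imp_refl one_imp)
  qed
qed

text \<open>Let w be the infimum of x and y. Swapping antecedents and applying
  \<open>imp_imp_eq\<close> to w \<preceq> x shows that x \<leadsto> w fixes y \<leadsto> w, so
  \<open>imp_fixed\<close> makes one of them 1.\<close>

lemma linear:
  assumes [simp]: "x \<in> carrier A" "y \<in> carrier A"
  shows "x \<preceq> y \<or> y \<preceq> x"
proof -
  define w where "w = x \<otimes> (x \<leadsto> y)"
  have [simp]: "w \<in> carrier A" and "w \<preceq> x"
    by (simp_all add: w_def mult_le_left)
  have x: "x \<leadsto> w = x \<leadsto> y"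
    unfolding w_def by (simp add: imp_inf imp_refl one_imp)
  have y: "y \<leadsto> w = y \<leadsto> x"
    using divisibility[of x y] imp_inf[of y x y] by (simp add: w_def imp_refl one_imp)
  have "(x \<leadsto> w) \<leadsto> (y \<leadsto> w) = y \<leadsto> w"
    using \<open>w \<preceq> x\<close> imp_swap[of "x \<leadsto> w" y w] by (simp add: imp_imp_eq) (simp add: y)
  then show ?thesis
    using imp_fixed[of "x \<leadsto> w" "y \<leadsto> w"] by (simp add: x y hoop_le_def)
qed

text \<open>By linearity both sides are the maximum of x and y.\<close>

lemma wajsberg:
  assumes [simp]: "x \<in> carrier A" "y \<in> carrier A"
  shows "(x \<leadsto> y) \<leadsto> y = (y \<leadsto> x) \<leadsto> x"
  using linear[of x y] imp_imp_eq[of x y] imp_imp_eq[of y x] by (auto simp: hoop_le_def one_imp)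

lemma ex_mv_chain: "\<exists>M :: 'a mv_sig. finite_mv_chain M \<and> id \<in> hoop_iso A (mv_hoop M)"
proof -
  obtain z where [simp]: "z \<in> carrier A" and z: "\<And>x. x \<in> carrier A \<Longrightarrow> z \<preceq> x"
    using least_element[OF finite_carrier] by blast
  \<comment> \<open>Negation has to be implication into the least element z; reading x \<leadsto> y
    as neg x \<oplus> y then dictates the sum.\<close>
  define M :: "'a mv_sig" where
    "M = \<lparr>carrier = carrier A, oplus = (\<lambda>x y. (x \<leadsto> z) \<leadsto> y), neg = (\<lambda>x. x \<leadsto> z), bot = z\<rparr>"
  have M [simp]: "carrier M = carrier A" "oplus M x y = (x \<leadsto> z) \<leadsto> y" "neg M x = x \<leadsto> z" "bot M = z" for x y
    by (simp_all add: M_def)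
  have neg_neg: "(x \<leadsto> z) \<leadsto> z = x" if "x \<in> carrier A" for x
    using that by (simp add: imp_imp_eq z)
  \<comment> \<open>The De Morgan form of the sum shows its commutativity.\<close>
  have oplus: "(x \<leadsto> z) \<leadsto> y = (x \<leadsto> z) \<otimes> (y \<leadsto> z) \<leadsto> z" if "x \<in> carrier A" "y \<in> carrier A" for x y
    using that by (simp add: imp_curry neg_neg)
  have mult: "(x \<leadsto> (y \<leadsto> z)) \<leadsto> z = x \<otimes> y" if "x \<in> carrier A" "y \<in> carrier A" for x y
    using neg_neg[of "x \<otimes> y"] that by (simp add: imp_curry)
  have "finite_mv_chain M"
  proof
    fix x y assume "x \<in> carrier M" "y \<in> carrier M"
    then have [simp]: "x \<in> carrier A" "y \<in> carrier A"
      by simp_all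
    show "oplus M x y = oplus M y x"
      by (simp add: oplus m_comm)
    show "oplus M (neg M (oplus M (neg M x) y)) y = oplus M (neg M (oplus M (neg M y) x)) x"
      using wajsberg[of x y] by (simp add: neg_neg)
    show "hoop_le (mv_hoop M) x y \<or> hoop_le (mv_hoop M) y x"
      using linear[of x y] by (simp add: mv_hoop_def neg_neg hoop_le_def imp_refl)
  next
    fix x assume "x \<in> carrier M"
    then have [simp]: "x \<in> carrier A"
      by simp
    show "oplus M x (neg M (bot M)) = neg M (bot M)"
      by (simp add: imp_refl imp_one)
  next
    fix u v w assume "u \<in> carrier M" "v \<in> carrier M" "w \<in> carrier M"
    then have [simp]: "u \<in> carrier A" "v \<in> carrier A" "w \<in> carrier A"
      by simp_all
    have "((u \<leadsto> z) \<leadsto> v) \<leadsto> z = (u \<leadsto> z) \<otimes> (v \<leadsto> z)"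
      using neg_neg[of "(u \<leadsto> z) \<otimes> (v \<leadsto> z)"] oplus[of u v] by simp
    then show "oplus M (oplus M u v) w = oplus M u (oplus M v w)"
      by (simp add: imp_curry)
  qed (simp_all add: neg_neg finite_carrier)
  moreover have "id \<in> hoop_iso A (mv_hoop M)"
    by (rule hoop_isoI) (simp_all add: mv_hoop_def mult neg_neg imp_refl)
  ultimately show ?thesis
    by blast
qed

end

lemma simple_chain_factor:
  assumes "hoop A" "finite (carrier A)" "simple_hoop A"
  obtains M where "finite_mv_chain M" "hoop_isomorphic A (chain_factor M)"
proof -
  interpret hoop A by fact
  \<comment> \<open>Elements are renamed to naturals first, since \<open>chain_factor\<close> takes
    chains on \<open>nat\<close> and \<open>ex_mv_chain\<close> keeps the type.\<close>
  obtain h :: "'a \<Rightarrow> nat" where inj: "inj_on h (carrier A)"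
    using finite_imp_inj_to_nat_seg[OF assms(2)] by blast
  let ?B = "hoop_copy h A"
  have iso: "h \<in> hoop_iso A ?B"
    using hoop_copy_iso[OF \<open>hoop A\<close> inj] .
  have B: "hoop ?B"
    using hoop_iso_hoop[OF \<open>hoop A\<close> iso] .
  interpret B: finite_simple_hoop ?B
    using B simple_hoop_iso[OF \<open>hoop A\<close> iso assms(3)] assms(2)
    by (intro finite_simple_hoop.intro finite_simple_hoop_axioms.intro)
      (simp_all add: hoop_copy_def Let_def)
  obtain M :: "nat mv_sig" where M: "finite_mv_chain M" "id \<in> hoop_iso ?B (mv_hoop M)"
    using B.ex_mv_chain by blast
  have "hoop_isomorphic (mv_hoop M) (chain_factor M)"
    unfolding chain_factor_def
    by (rule hoop_isomorphic_copy[OF hoop_iso_hoop[OF B M(2)]]) (simp add: inj_on_def)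
  moreover have "hoop_isomorphic A (mv_hoop M)"
    using hoop_iso_comp[OF iso M(2)] unfolding hoop_isomorphic_def by blast
  ultimately show thesis
    using that M(1) hoop_isomorphic_trans by blast
qed


section \<open>Decompositions\<close>

text \<open>Maximality leaves only e and 1 as idempotents above e. The cardinality drops because e
  \<leadsto> e = 1 keeps e out of \<open>quot\<close>.\<close>

lemma not_simple_maximal:
  assumes "hoop A" "finite (carrier A)" "\<not> simple_hoop A"
  obtains e where "hoop_idempotent A e" "simple_hoop (hoop_idempotent.Filt A e)"
    "card (hoop_idempotent.quot A e) < card (carrier A)"
proof -
  interpret hoop A by fact
  let ?E = "{i \<in> carrier A. i \<otimes>\<^bsub>A\<^esub> i = i \<and> i \<noteq> \<one>\<^bsub>A\<^esub>}"
  have "?E \<subseteq> carrier A" "finite ?E" "?E \<noteq> {}"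
    using assms(2,3) by (auto simp: simple_hoop_def)
  then obtain e where e: "e \<in> ?E" and max: "\<And>i. \<lbrakk>i \<in> ?E; e \<preceq> i\<rbrakk> \<Longrightarrow> i = e"
    using ex_maximal[of ?E] by blast
  interpret hoop_idempotent A e
    using e assms(2) by unfold_locales auto
  have "simple_hoop Filt"
    unfolding simple_hoop_def
  proof (intro ballI impI)
    fix i assume "i \<in> carrier Filt" "i \<otimes>\<^bsub>Filt\<^esub> i = i"
    then have "i = \<one>\<^bsub>A\<^esub> \<or> i = e"
      using max[of i] filt_le[of i] filt_carrier[of i] by auto
    then show "i = \<one>\<^bsub>Filt\<^esub> \<or> (\<forall>x\<in>carrier Filt. hoop_le Filt i x)"
      using filt_le by (auto simp: hoop_le_def)
  qed
  moreover have "e \<notin> quot"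
    using e quot_fixed[of e] by (auto simp: imp_refl)
  then have "card quot < card (carrier A)"
    using e finite_carrier by (intro psubset_card_mono) auto
  ultimately show thesis
    using that hoop_idempotent_axioms by blast
qed

text \<open>For an idempotent x of \<open>quot\<close>, e x is an idempotent below e, hence e or the
  least element z; then x is 1 or least in \<open>quot\<close>, respectively. The cardinality drops
  because z is not in \<open>filt\<close>.\<close>

lemma not_simple_minimal:
  assumes "hoop A" "finite (carrier A)" "\<not> simple_hoop A"
  obtains e where "hoop_idempotent A e" "simple_hoop (hoop_idempotent.Quot A e)"
    "card (hoop_idempotent.filt A e) < card (carrier A)"
proof -
  interpret hoop A by fact
  obtain z where z: "z \<in> carrier A" "\<And>x. x \<in> carrier A \<Longrightarrow> z \<preceq> x"
    using least_element[OF assms(2)] by blast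
  let ?E = "{i \<in> carrier A. i \<otimes>\<^bsub>A\<^esub> i = i \<and> i \<noteq> z}"
  have "?E \<subseteq> carrier A" "finite ?E" "?E \<noteq> {}"
    using assms(2,3) z(2) by (auto simp: simple_hoop_def)
  then obtain e where e: "e \<in> ?E" and min: "\<And>i. \<lbrakk>i \<in> ?E; i \<preceq> e\<rbrakk> \<Longrightarrow> i = e"
    using ex_minimal[of ?E] by blast
  interpret hoop_idempotent A e
    using e assms(2) by unfold_locales auto
  have "x = \<one>\<^bsub>A\<^esub> \<or> (\<forall>y\<in>quot. x \<preceq> y)" if x: "x \<in> quot" "x \<otimes>\<^bsub>A\<^esub> x = x" for x
  proof -
    have "(e \<otimes>\<^bsub>A\<^esub> x) \<otimes>\<^bsub>A\<^esub> (e \<otimes>\<^bsub>A\<^esub> x) = (e \<otimes>\<^bsub>A\<^esub> e) \<otimes>\<^bsub>A\<^esub> (x \<otimes>\<^bsub>A\<^esub> x)"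
      using x(1) by (simp add: m_ac)
    then have "(e \<otimes>\<^bsub>A\<^esub> x) \<otimes>\<^bsub>A\<^esub> (e \<otimes>\<^bsub>A\<^esub> x) = e \<otimes>\<^bsub>A\<^esub> x"
      using x e_idem by simp
    then consider "e \<otimes>\<^bsub>A\<^esub> x = z" | "e \<otimes>\<^bsub>A\<^esub> x = e"
      using min[of "e \<otimes>\<^bsub>A\<^esub> x"] x(1) mult_le_left[of e x] by auto
    then show ?thesis
    proof cases
      case 1
      then have "x \<preceq> e \<leadsto>\<^bsub>A\<^esub> y" if "y \<in> quot" for y
        using that x(1) z(2)[of y] by (simp add: m_comm flip: residuation)
      then show ?thesis
        by (simp add: quot_fixed)
    next
      case 2
      then have "e \<leadsto>\<^bsub>A\<^esub> x = \<one>\<^bsub>A\<^esub>"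
        using x(1) mult_le_right[of e x] by (simp add: hoop_le_def)
      then show ?thesis
        using quot_fixed[OF x(1)] by simp
    qed
  qed
  then have "simple_hoop Quot"
    by (auto simp: simple_hoop_def hoop_le_def)
  moreover have "z \<notin> filt"
    using e z le_antisym[of e z] filt_le by auto
  then have "card filt < card (carrier A)"
    using z(1) finite_carrier by (intro psubset_card_mono) auto
  ultimately show thesis
    using that hoop_idempotent_axioms by blast
qed

section \<open>The two decompositions by induction on the cardinality\<close>

lemma right_decomposition:
  fixes A :: "'a hoop_sig"
  assumes "hoop A" "finite (carrier A)"
  shows "\<exists>Ms fs P. (\<forall>M\<in>set Ms. finite_mv_chain M) \<and> right_nested_product Ms fs P \<and> hoop_isomorphic A P"
  using assms
proof (induction "card (carrier A)" arbitrary: A rule: less_induct)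
  case less
  show ?case
  proof (cases "simple_hoop A")
    case True
    obtain M where "finite_mv_chain M" "hoop_isomorphic A (chain_factor M)"
      using simple_chain_factor[OF less.prems True] by blast
    then show ?thesis
      using right_nested_product.single[of M] by (intro exI[of _ "[M]"]) auto
  next
    case False
    obtain e where e: "hoop_idempotent A e" "simple_hoop (hoop_idempotent.Filt A e)"
        "card (hoop_idempotent.quot A e) < card (carrier A)"
      using not_simple_maximal[OF less.prems False] by blast
    interpret hoop_idempotent A e by fact
    have fin: "finite filt" "finite quot"
      using finite_subset[OF _ finite_carrier] by (auto simp: subset_iff)
    obtain M where M: "finite_mv_chain M" "hoop_isomorphic Filt (chain_factor M)"
      using simple_chain_factor[OF hoop_Filt _ e(2)] fin by auto
    obtain Ms fs P where P: "\<forall>M\<in>set Ms. finite_mv_chain M" "right_nested_product Ms fs P"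
        "hoop_isomorphic Quot P"
      \<comment> \<open>\<open>Quot\<close> is A with a smaller carrier on the same type, so the
        induction hypothesis covers it.\<close>
      using less.hyps[of Quot] e(3) hoop_Quot fin by auto
    obtain f where "product_morphism P (chain_factor M) f"
        "hoop_isomorphic A (nested_product f (chain_factor M) P)"
      using nested_product_isomorphic[OF less.prems(1) hoop_Filt hoop_Quot product_morphism_cover
          isomorphic_f_product M(2) P(3)] by blast
    then show ?thesis
      using right_nested_product.step[OF P(2)] P(1) M(1)
      by (intro exI[of _ "M # Ms"] exI[of _ "f # fs"]) auto
  qed
qed

lemma left_decomposition:
  fixes A :: "'a hoop_sig"
  assumes "hoop A" "finite (carrier A)"
  shows "\<exists>Ms gs P. (\<forall>M\<in>set Ms. finite_mv_chain M) \<and> left_nested_product Ms gs P \<and> hoop_isomorphic A P"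
  using assms
proof (induction "card (carrier A)" arbitrary: A rule: less_induct)
  case less
  show ?case
  proof (cases "simple_hoop A")
    case True
    obtain M where "finite_mv_chain M" "hoop_isomorphic A (chain_factor M)"
      using simple_chain_factor[OF less.prems True] by blast
    then show ?thesis
      using left_nested_product.single[of M] by (intro exI[of _ "[M]"]) auto
  next
    case False
    obtain e where e: "hoop_idempotent A e" "simple_hoop (hoop_idempotent.Quot A e)"
        "card (hoop_idempotent.filt A e) < card (carrier A)"
      using not_simple_minimal[OF less.prems False] by blast
    interpret hoop_idempotent A e by fact
    have fin: "finite filt" "finite quot"
      using finite_subset[OF _ finite_carrier] by (auto simp: subset_iff)
    obtain M where M: "finite_mv_chain M" "hoop_isomorphic Quot (chain_factor M)"
      using simple_chain_factor[OF hoop_Quot _ e(2)] fin by auto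
    obtain Ms gs P where P: "\<forall>M\<in>set Ms. finite_mv_chain M" "left_nested_product Ms gs P"
        "hoop_isomorphic Filt P"
      \<comment> \<open>Now the recursion runs through the left factor, so the new chain goes to the
        end of the list.\<close>
      using less.hyps[of Filt] e(3) hoop_Filt fin by auto
    obtain g where "product_morphism (chain_factor M) P g"
        "hoop_isomorphic A (nested_product g P (chain_factor M))"
      using nested_product_isomorphic[OF less.prems(1) hoop_Filt hoop_Quot product_morphism_cover
          isomorphic_f_product P(3) M(2)] by blast
    then show ?thesis
      using left_nested_product.step[OF P(2)] P(1) M(1)
      by (intro exI[of _ "Ms @ [M]"] exI[of _ "gs @ [g]"]) auto
  qed
qed

theorem theorem18:
  fixes A :: "'a hoop_sig"
  assumes "hoop A" and "finite (carrier A)"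
  shows "(\<exists>Ms fs P. (\<forall>M\<in>set Ms. finite_mv_chain M) \<and> right_nested_product Ms fs P \<and> hoop_isomorphic A P)
       \<and> (\<exists>Ms gs P. (\<forall>M\<in>set Ms. finite_mv_chain M) \<and> left_nested_product Ms gs P \<and> hoop_isomorphic A P)"
  using right_decomposition[OF assms] left_decomposition[OF assms] ..

end
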